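(* Let $n\ge 3$ and let $s\ge 1$ be an integer. The set of Nakajima monomials $$\mathcal{M}^{1,s}=\Big\{\prod_{i=1}^n Y_{i-1,1}^{-x_i}Y_{i,0}^{x_i}\ \Big|\ x_1,\dots,x_n\in\mathbb{Z}_{\ge 0},\ \sum_{i=1}^n x_i=s\Big\}$$ (first indices taken mod $n$), with the functions $\mathrm{wt},\varepsilon_i,\varphi_i$ and operators $e_i,f_i$ ($i\in I$) of the Nakajima monomial crystal structure, is isomorphic to the Kirillov--Reshetikhin crystal $B^{1,s}$ as a $U_q'(\widehat{\mathfrak{sl}}_n)$-crystal.
   Context: Crystals. $I=\mathbb{Z}/n\mathbb{Z}=\{0,1,\dots,n-1\}$ is the index set of $\widehat{\mathfrak{sl}}_n$ (type $A_{n-1}^{(1)}$), with fundamental weights $\Lambda_i$, and simple roots $\alpha_i=2\Lambda_i-\Lambda_{i-1}-\Lambda_{i+1}$ as $U_q'(\widehat{\mathfrak{sl}}_n)$-weights (that is, modulo the null root $\delta$). A $U_q'(\widehat{\mathfrak{sl}}_n)$-crystal is a set $B$ with maps $e_i,f_i:B\to B\sqcup\{0\}$, $\varepsilon_i,\varphi_i:B\to\mathbb{Z}$ and $\mathrm{wt}:B\to\bigoplus_i\mathbb{Z}\Lambda_i$ satisfying the usual crystal axioms. An isomorphism of crystals is a bijection that preserves $\mathrm{wt},\varepsilon_i,\varphi_i$ and commutes with all $e_i,f_i$ (with $0\mapsto 0$). Nakajima monomials. $\mathcal{M}$ is the set of Laurent monomials $m=\prod_{i\in I,k\in\mathbb{Z}}Y_{i,k}^{y_{i,k}}$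 (finitely many nonzero exponents) in commuting variables $Y_{i,k}$. Put $\mathrm{wt}(m)=\sum_{i,k}y_{i,k}\Lambda_i$, $\ \varepsilon_i(m)=-\min_{k\in\mathbb{Z}}\sum_{t\ge k}y_{i,t}$, $\ \varphi_i(m)=\max_{k\in\mathbb{Z}}\sum_{t\le k}y_{i,t}$, $\ k_e(m)=\max\{k\mid \varepsilon_i(m)=-\sum_{t\ge k}y_{i,t}\}$ (used when $\varepsilon_i(m)>0$), $\ k_f(m)=\min\{k\mid\varphi_i(m)=\sum_{t\le k}y_{i,t}\}$ (used when $\varphi_i(m)>0$). With $A_{i,k}=Y_{i,k}Y_{i,k+1}Y_{i-1,k+1}^{-1}Y_{i+1,k}^{-1}$, set $e_i(m)=0$ if $\varepsilon_i(m)=0$ and $e_i(m)=m\,A_{i,k_e(m)-1}$ otherwise; $f_i(m)=0$ if $\varphi_i(m)=0$ and $f_i(m)=m\,A_{i,k_f(m)}^{-1}$ otherwise. The crystal $B^{1,s}$ (vector realization). $B^{1,s}=\{(x_1,\dots,x_n)\in\mathbb{Z}_{\ge0}^n\mid\sum_i x_i=s\}$, with indices mod $n$ (so $x_0=x_n$), and for $i\in I$: $\varepsilon_i(x)=x_{i+1}$, $\varphi_i(x)=x_i$, $\mathrm{wt}(x)=\sum_{i\in I}(x_i-x_{i+1})\Lambda_i$; $e_i(x)=0$ if $x_{i+1}=0$, and otherwise $e_i$ increases $x_i$ by $1$ and decreases $x_{i+1}$ by $1$; $f_i(x)=0$ if $x_i=0$, and otherwise $f_i$ decreases $x_i$ by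 $1$ and increases $x_{i+1}$ by $1$. *)

theory Defs
  imports Main "HOL-Library.Poly_Mapping"
begin

text \<open>
  Residue classes modulo \<open>n\<close> are represented by integers; \<open>I n\<close> is the standard set of
  representatives.  The weight lattice modulo the null root is the free abelian group on the
  fundamental weights, and the coefficient of \<open>fund_weight n i\<close> in a weight is its pairing
  with the \<open>i\<close>-th simple coroot.
\<close>

definition I :: "nat \<Rightarrow> int set" where
  "I n = {0..<int n}"

type_synonym weight = "int \<Rightarrow>\<^sub>0 int"

definition fund_weight :: "nat \<Rightarrow> int \<Rightarrow> weight" where
  "fund_weight n i = Poly_Mapping.single (i mod int n) 1"

definition simple_root :: "nat \<Rightarrow> int \<Rightarrow> weight" where
  "simple_root n i =
     fund_weight n i + fund_weight n i - fund_weight n (i - 1) - fund_weight n (i + 1)"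

text \<open>The value \<open>None\<close> plays the role of the extra element \<open>0\<close> of \<open>B \<squnion> {0}\<close>.\<close>

record 'b crystal_data =
  elems :: "'b set"
  wt :: "'b \<Rightarrow> weight"
  eps :: "int \<Rightarrow> 'b \<Rightarrow> int"
  phi :: "int \<Rightarrow> 'b \<Rightarrow> int"
  e_op :: "int \<Rightarrow> 'b \<Rightarrow> 'b option"
  f_op :: "int \<Rightarrow> 'b \<Rightarrow> 'b option"

locale affine_crystal =
  fixes n :: nat and B :: "'b crystal_data"
  assumes wt_lattice: "b \<in> elems B \<Longrightarrow> Poly_Mapping.keys (wt B b) \<subseteq> I n"
    and e_closed: "\<lbrakk>i \<in> I n; b \<in> elems B; e_op B i b = Some b'\<rbrakk> \<Longrightarrow> b' \<in> elems B"
    and f_closed: "\<lbrakk>i \<in> I n; b \<in> elems B; f_op B i b = Some b'\<rbrakk> \<Longrightarrow> b' \<in> elems B"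
    and phi_eps: "\<lbrakk>i \<in> I n; b \<in> elems B\<rbrakk> \<Longrightarrow>
      phi B i b = eps B i b + Poly_Mapping.lookup (wt B b) i"
    and e_wt: "\<lbrakk>i \<in> I n; b \<in> elems B; e_op B i b = Some b'\<rbrakk> \<Longrightarrow>
      wt B b' = wt B b + simple_root n i"
    and e_eps: "\<lbrakk>i \<in> I n; b \<in> elems B; e_op B i b = Some b'\<rbrakk> \<Longrightarrow> eps B i b' = eps B i b - 1"
    and e_phi: "\<lbrakk>i \<in> I n; b \<in> elems B; e_op B i b = Some b'\<rbrakk> \<Longrightarrow> phi B i b' = phi B i b + 1"
    and f_wt: "\<lbrakk>i \<in> I n; b \<in> elems B; f_op B i b = Some b'\<rbrakk> \<Longrightarrow>
      wt B b' = wt B b - simple_root n i"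
    and f_eps: "\<lbrakk>i \<in> I n; b \<in> elems B; f_op B i b = Some b'\<rbrakk> \<Longrightarrow> eps B i b' = eps B i b + 1"
    and f_phi: "\<lbrakk>i \<in> I n; b \<in> elems B; f_op B i b = Some b'\<rbrakk> \<Longrightarrow> phi B i b' = phi B i b - 1"
    and e_f: "\<lbrakk>i \<in> I n; b \<in> elems B; b' \<in> elems B\<rbrakk> \<Longrightarrow>
      e_op B i b = Some b' \<longleftrightarrow> f_op B i b' = Some b"

definition crystal_iso :: "nat \<Rightarrow> 'b crystal_data \<Rightarrow> 'c crystal_data \<Rightarrow> ('b \<Rightarrow> 'c) \<Rightarrow> bool" where
  "crystal_iso n B C \<psi> \<longleftrightarrow>
     bij_betw \<psi> (elems B) (elems C) \<and>
     (\<forall>b\<in>elems B. wt C (\<psi> b) = wt B b) \<and>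
     (\<forall>i\<in>I n. \<forall>b\<in>elems B.
        eps C i (\<psi> b) = eps B i b \<and>
        phi C i (\<psi> b) = phi B i b \<and>
        e_op C i (\<psi> b) = map_option \<psi> (e_op B i b) \<and>
        f_op C i (\<psi> b) = map_option \<psi> (f_op B i b))"

definition crystal_isomorphic :: "nat \<Rightarrow> 'b crystal_data \<Rightarrow> 'c crystal_data \<Rightarrow> bool" where
  "crystal_isomorphic n B C \<longleftrightarrow>
     affine_crystal n B \<and> affine_crystal n C \<and> (\<exists>\<psi>. crystal_iso n B C \<psi>)"

definition restrict_elems :: "'b crystal_data \<Rightarrow> 'b set \<Rightarrow> 'b crystal_data" where
  "restrict_elems B S = B\<lparr>elems := S\<rparr>"

text \<open>
  A Laurent monomial is given by its finitely supported exponents, \<open>(i, k)\<close> being mapped to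
  the exponent of \<open>Y\<^bsub>i,k\<^esub>\<close>.  Hence the product of monomials is written additively, and
  \<open>Y_pow n i k a\<close> is the monomial \<open>Y\<^bsub>i,k\<^esub>\<close> to the power \<open>a\<close>.
\<close>

type_synonym monomial = "int \<times> int \<Rightarrow>\<^sub>0 int"

definition Y_pow :: "nat \<Rightarrow> int \<Rightarrow> int \<Rightarrow> int \<Rightarrow> monomial" where
  "Y_pow n i k a = Poly_Mapping.single (i mod int n, k) a"

definition A_mon :: "nat \<Rightarrow> int \<Rightarrow> int \<Rightarrow> monomial" where
  "A_mon n i k = Y_pow n i k 1 + Y_pow n i (k + 1) 1
     + Y_pow n (i - 1) (k + 1) (- 1) + Y_pow n (i + 1) k (- 1)"

definition mon_wt :: "nat \<Rightarrow> monomial \<Rightarrow> weight" where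
  "mon_wt n m =
     (\<Sum>(i, k)\<in>Poly_Mapping.keys m. Poly_Mapping.single (i mod int n) (Poly_Mapping.lookup m (i, k)))"

definition upper_sum :: "int \<Rightarrow> monomial \<Rightarrow> int \<Rightarrow> int" where
  "upper_sum i m k =
     (\<Sum>t | (i, t) \<in> Poly_Mapping.keys m \<and> k \<le> t. Poly_Mapping.lookup m (i, t))"

definition lower_sum :: "int \<Rightarrow> monomial \<Rightarrow> int \<Rightarrow> int" where
  "lower_sum i m k =
     (\<Sum>t | (i, t) \<in> Poly_Mapping.keys m \<and> t \<le> k. Poly_Mapping.lookup m (i, t))"

text \<open>
  The partial sums take finitely many values, so \<open>Min\<close> and \<open>Max\<close> are meaningful in \<open>mon_eps\<close>
  and \<open>mon_phi\<close>.  The sets of indices attaining these values may be infinite in one direction,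
  hence \<open>GREATEST\<close> and \<open>LEAST\<close> in \<open>k_e\<close> and \<open>k_f\<close>.
\<close>

definition mon_eps :: "int \<Rightarrow> monomial \<Rightarrow> int" where
  "mon_eps i m = - Min (range (upper_sum i m))"

definition mon_phi :: "int \<Rightarrow> monomial \<Rightarrow> int" where
  "mon_phi i m = Max (range (lower_sum i m))"

definition k_e :: "int \<Rightarrow> monomial \<Rightarrow> int" where
  "k_e i m = (GREATEST k. mon_eps i m = - upper_sum i m k)"

definition k_f :: "int \<Rightarrow> monomial \<Rightarrow> int" where
  "k_f i m = (LEAST k. mon_phi i m = lower_sum i m k)"

definition mon_e :: "nat \<Rightarrow> int \<Rightarrow> monomial \<Rightarrow> monomial option" where
  "mon_e n i m = (if mon_eps i m = 0 then None else Some (m + A_mon n i (k_e i m - 1)))"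

definition mon_f :: "nat \<Rightarrow> int \<Rightarrow> monomial \<Rightarrow> monomial option" where
  "mon_f n i m = (if mon_phi i m = 0 then None else Some (m - A_mon n i (k_f i m)))"

definition nakajima_monomials :: "nat \<Rightarrow> monomial crystal_data" where
  "nakajima_monomials n =
     \<lparr>elems = {m. Poly_Mapping.keys m \<subseteq> I n \<times> UNIV}, wt = mon_wt n,
      eps = mon_eps, phi = mon_phi, e_op = mon_e n, f_op = mon_f n\<rparr>"

text \<open>
  A tuple \<open>(x\<^sub>1, \<dots>, x\<^sub>n)\<close> is a list of length \<open>n\<close>; \<open>pos n i\<close> is the (zero-based) position at
  which its \<open>i\<close>-th entry is stored, with \<open>i\<close> read modulo \<open>n\<close>, so that \<open>entry n x 0\<close> is
  \<open>x\<^sub>n\<close>, the last entry.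
\<close>

definition pos :: "nat \<Rightarrow> int \<Rightarrow> nat" where
  "pos n i = nat ((i - 1) mod int n)"

definition entry :: "nat \<Rightarrow> nat list \<Rightarrow> int \<Rightarrow> nat" where
  "entry n x i = x ! pos n i"

definition tuples :: "nat \<Rightarrow> nat \<Rightarrow> nat list set" where
  "tuples n s = {x. length x = n \<and> sum_list x = s}"

definition KR_wt :: "nat \<Rightarrow> nat list \<Rightarrow> weight" where
  "KR_wt n x =
     (\<Sum>i\<in>I n. Poly_Mapping.single i (int (entry n x i) - int (entry n x (i + 1))))"

definition KR_e :: "nat \<Rightarrow> int \<Rightarrow> nat list \<Rightarrow> nat list option" where
  "KR_e n i x =
     (if entry n x (i + 1) = 0 then None
      else Some (x[pos n i := entry n x i + 1, pos n (i + 1) := entry n x (i + 1) - 1]))"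

definition KR_f :: "nat \<Rightarrow> int \<Rightarrow> nat list \<Rightarrow> nat list option" where
  "KR_f n i x =
     (if entry n x i = 0 then None
      else Some (x[pos n i := entry n x i - 1, pos n (i + 1) := entry n x (i + 1) + 1]))"

definition KR_crystal :: "nat \<Rightarrow> nat \<Rightarrow> nat list crystal_data" where
  "KR_crystal n s =
     \<lparr>elems = tuples n s, wt = KR_wt n,
      eps = (\<lambda>i x. int (entry n x (i + 1))), phi = (\<lambda>i x. int (entry n x i)),
      e_op = KR_e n, f_op = KR_f n\<rparr>"

definition M1 :: "nat \<Rightarrow> nat \<Rightarrow> monomial set" where
  "M1 n s =
     {\<Sum>i = 1..int n. Y_pow n (i - 1) 1 (- int (entry n x i)) + Y_pow n i 0 (int (entry n x i))
      | x. x \<in> tuples n s}"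

end

theory Submission
  imports Defs
begin

text \<open>
  The tuple \<open>x\<close> corresponds to the monomial with exponents \<open>x\<^sub>i\<close> at \<open>Y\<^bsub>i,0\<^esub>\<close> and
  \<open>-x\<^bsub>i+1\<^esub>\<close> at \<open>Y\<^bsub>i,1\<^esub>\<close>.  For fixed \<open>i\<close> its partial sums from above are \<open>0\<close>, \<open>-x\<^bsub>i+1\<^esub>\<close> and
  \<open>x\<^sub>i - x\<^bsub>i+1\<^esub>\<close>, and those from below are \<open>0\<close>, \<open>x\<^sub>i\<close> and \<open>x\<^sub>i - x\<^bsub>i+1\<^esub>\<close>.  Hence \<open>\<epsilon>\<^sub>i = x\<^bsub>i+1\<^esub>\<close>
  and \<open>\<phi>\<^sub>i = x\<^sub>i\<close>, the extrema being attained at \<open>k\<^sub>e = 1\<close> and \<open>k\<^sub>f = 0\<close> when they are nonzero,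
  so that both operators multiply by \<open>A\<^bsub>i,0\<^esub>\<close> or its inverse, which moves one unit between
  \<open>x\<^sub>i\<close> and \<open>x\<^bsub>i+1\<^esub>\<close>.
\<close>

section \<open>Transport of the crystal axioms along an isomorphism\<close>

lemma crystal_iso_affine:
  assumes B: "affine_crystal n B" and iso: "crystal_iso n B C \<psi>"
  shows "affine_crystal n C"
proof -
  interpret affine_crystal n B by (fact B)
  have bij: "bij_betw \<psi> (elems B) (elems C)"
    and wt: "\<And>b. b \<in> elems B \<Longrightarrow> wt C (\<psi> b) = wt B b"
    and eps: "\<And>i b. i \<in> I n \<Longrightarrow> b \<in> elems B \<Longrightarrow> eps C i (\<psi> b) = eps B i b"
    and phi: "\<And>i b. i \<in> I n \<Longrightarrow> b \<in> elems B \<Longrightarrow> phi C i (\<psi> b) = phi B i b"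
    and e: "\<And>i b. i \<in> I n \<Longrightarrow> b \<in> elems B \<Longrightarrow> e_op C i (\<psi> b) = map_option \<psi> (e_op B i b)"
    and f: "\<And>i b. i \<in> I n \<Longrightarrow> b \<in> elems B \<Longrightarrow> f_op C i (\<psi> b) = map_option \<psi> (f_op B i b)"
    using iso unfolding crystal_iso_def by auto
  have elems: "elems C = \<psi> ` elems B" and inj: "inj_on \<psi> (elems B)"
    using bij by (auto simp: bij_betw_def)
  \<comment> \<open>Injectivity cancels \<open>\<psi>\<close> under \<open>map_option\<close>;
    closure of \<open>B\<close> puts the operator values where \<open>\<psi>\<close> is
    injective.\<close>
  have e_f': "e_op C i (\<psi> b) = Some (\<psi> b') \<longleftrightarrow> f_op C i (\<psi> b') = Some (\<psi> b)"
    if "i \<in> I n" "b \<in> elems B" "b' \<in> elems B" for i b b'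
  proof -
    have "e_op C i (\<psi> b) = Some (\<psi> b') \<longleftrightarrow> e_op B i b = Some b'"
      using that inj e_closed by (auto simp: e dest: inj_onD)
    moreover have "f_op C i (\<psi> b') = Some (\<psi> b) \<longleftrightarrow> f_op B i b' = Some b"
      using that inj f_closed by (auto simp: f dest: inj_onD)
    ultimately show ?thesis using e_f that by blast
  qed
  have eE: thesis if "e_op C i (\<psi> b) = Some c" "i \<in> I n" "b \<in> elems B"
    "\<And>b'. e_op B i b = Some b' \<Longrightarrow> b' \<in> elems B \<Longrightarrow> c = \<psi> b' \<Longrightarrow> thesis" for i b c thesis
    using that e_closed by (auto simp: e)
  have fE: thesis if "f_op C i (\<psi> b) = Some c" "i \<in> I n" "b \<in> elems B"
    "\<And>b'. f_op B i b = Some b' \<Longrightarrow> b' \<in> elems B \<Longrightarrow> c = \<psi> b' \<Longrightarrow> thesis" for i b c thesis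
    using that f_closed by (auto simp: f)
  show ?thesis
  proof
    show "e_op C i c = Some c' \<longleftrightarrow> f_op C i c' = Some c"
      if "i \<in> I n" "c \<in> elems C" "c' \<in> elems C" for i c c'
      using that e_f' by (auto simp: elems)
  qed (auto simp: elems wt eps phi elim!: eE fE dest: subsetD[OF wt_lattice]
      intro: phi_eps e_wt e_eps e_phi f_wt f_eps f_phi)
qed

text \<open>Closure of \<open>B\<close> under the operators ensures that the inverse undoes
  \<open>\<psi>\<close> on their values as well.\<close>

lemma crystal_iso_inv_into:
  assumes B: "affine_crystal n B" and iso: "crystal_iso n B C \<psi>"
  shows "crystal_iso n C B (inv_into (elems B) \<psi>)"
proof -
  interpret affine_crystal n B by (fact B)
  have bij: "bij_betw \<psi> (elems B) (elems C)" using iso by (simp add: crystal_iso_def)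
  then have elems: "elems C = \<psi> ` elems B" and inj: "inj_on \<psi> (elems B)"
    by (auto simp: bij_betw_def)
  have e: "map_option (inv_into (elems B) \<psi>) (map_option \<psi> (e_op B i b)) = e_op B i b"
    if "i \<in> I n" "b \<in> elems B" for i b
    using e_closed[OF that] inj by (cases "e_op B i b") auto
  have f: "map_option (inv_into (elems B) \<psi>) (map_option \<psi> (f_op B i b)) = f_op B i b"
    if "i \<in> I n" "b \<in> elems B" for i b
    using f_closed[OF that] inj by (cases "f_op B i b") auto
  show ?thesis
    \<comment> \<open>Fusing nested \<open>map_option\<close> is disabled so that \<open>e\<close>
      and \<open>f\<close> apply.\<close>
    using iso bij_betw_inv_into[OF bij] inj e f
    unfolding crystal_iso_def by (auto simp: elems simp del: option.map_comp)
qed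

text \<open>Leaves the crystal axioms to be checked on the source \<open>C\<close> only. Here
  \<open>C\<close> will be the tuples, where the operators are explicit, and \<open>B\<close> the
  monomials.\<close>

lemma crystal_isomorphic_if_iso_from:
  assumes "affine_crystal n C" "crystal_iso n C B \<psi>"
  shows "crystal_isomorphic n B C"
  using assms crystal_iso_affine[OF assms] crystal_iso_inv_into[OF assms]
  by (auto simp: crystal_isomorphic_def)


section \<open>The vector realization\<close>

lemma pos_less: "n > 0 \<Longrightarrow> pos n i < n"
  by (simp add: pos_def nat_less_iff)

lemma pos_eq_iff: "n > 0 \<Longrightarrow> pos n i = pos n j \<longleftrightarrow> i mod int n = j mod int n"
  by (simp add: pos_def nat_eq_iff mod_eq_dvd_iff)

text \<open>Ensures that the two successive list updates in \<open>KR_e\<close> and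
  \<open>KR_f\<close> do not overwrite each other.\<close>

lemma pos_succ_neq: "n \<ge> 2 \<Longrightarrow> pos n i \<noteq> pos n (i + 1)"
  by (simp add: pos_eq_iff mod_eq_dvd_iff)

lemma entry_cong: "n > 0 \<Longrightarrow> i mod int n = j mod int n \<Longrightarrow> entry n x i = entry n x j"
  using pos_eq_iff[of n i j] by (simp add: entry_def)

lemma entry_update:
  assumes "n > 0" "length x = n"
  shows "entry n (x[pos n i := a, pos n j := b]) l =
    (if l mod int n = j mod int n then b else if l mod int n = i mod int n then a
     else entry n x l)"
  using assms(1) by (auto simp: entry_def nth_list_update assms(2) pos_less pos_eq_iff)

lemma tuple_eqI:
  assumes "length x = n" "length y = n" "\<And>i. i \<in> I n \<Longrightarrow> entry n x i = entry n y i"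
  shows "x = y"
proof (rule nth_equalityI)
  \<comment> \<open>Zero-based position \<open>k\<close> stores the entry of index
    \<open>k + 1\<close>; its representative in \<open>I n\<close> is 0 for the last
    position.\<close>
  fix k assume k: "k < length x"
  have "pos n ((int k + 1) mod int n) = k"
    using k assms(1) by (simp add: pos_def mod_diff_left_eq)
  moreover have "(int k + 1) mod int n \<in> I n"
    using k assms(1) by (simp add: I_def)
  ultimately show "x ! k = y ! k"
    using assms(3) by (metis entry_def)
qed (use assms in simp)

section \<open>Crystal operators and axioms on tuples\<close>

lemma KR_e_in_tuples:
  assumes "n \<ge> 2" "x \<in> tuples n s" "KR_e n i x = Some y"
  shows "y \<in> tuples n s"
proof -
  have p: "pos n i < length x" "pos n (i + 1) < length x"
    using assms pos_less by (auto simp: tuples_def)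
  have "x ! pos n i \<le> sum_list x"
    using p by (intro member_le_sum_list) auto
  then show ?thesis
    using assms p pos_succ_neq[of n i]
    by (auto simp: KR_e_def tuples_def sum_list_update entry_def split: if_splits)
qed

lemma KR_f_in_tuples:
  assumes "n \<ge> 2" "x \<in> tuples n s" "KR_f n i x = Some y"
  shows "y \<in> tuples n s"
proof -
  have p: "pos n i < length x" "pos n (i + 1) < length x"
    using assms pos_less by (auto simp: tuples_def)
  \<comment> \<open>\<open>sum_list_update\<close> subtracts in the naturals; this bound keeps the
    subtraction exact when a nonzero entry loses a unit.\<close>
  have "x ! pos n i \<le> sum_list x"
    using p by (intro member_le_sum_list) auto
  then show ?thesis
    using assms p pos_succ_neq[of n i]
    by (auto simp: KR_f_def tuples_def sum_list_update entry_def split: if_splits)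
qed

text \<open>Passing to integers with indicator terms removes truncated subtraction; the same formula
  serves the weights and the exponents of the monomials.\<close>

lemma KR_e_entry:
  assumes "n \<ge> 2" "length x = n" "KR_e n i x = Some y"
  shows "int (entry n y l) = int (entry n x l)
    + (if l mod int n = i mod int n then 1 else 0)
    - (if l mod int n = (i + 1) mod int n then 1 else 0)"
proof -
  have "i mod int n \<noteq> (i + 1) mod int n"
    using assms(1) by (simp add: mod_eq_dvd_iff)
  moreover have n: "n > 0" using assms(1) by simp
  moreover have y: "y = x[pos n i := entry n x i + 1, pos n (i + 1) := entry n x (i + 1) - 1]"
    and "entry n x (i + 1) > 0"
    using assms(3) by (auto simp: KR_e_def split: if_splits)
  ultimately show ?thesis
    unfolding y entry_update[OF n assms(2)]
    using entry_cong[of n l i x] entry_cong[of n l "i + 1" x] by auto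
qed

text \<open>Both operators move one unit between the same two positions, in opposite directions.
  This lets facts about \<open>KR_f\<close> be read off from those about
  \<open>KR_e\<close>.\<close>

lemma KR_e_iff_KR_f:
  assumes "n \<ge> 2" "length x = n" "length y = n"
  shows "KR_e n i x = Some y \<longleftrightarrow> KR_f n i y = Some x"
proof -
  have p: "pos n i < n" "pos n (i + 1) < n" "pos n i \<noteq> pos n (i + 1)"
    using assms pos_less pos_succ_neq by auto
  show ?thesis
  proof
    assume e: "KR_e n i x = Some y"
    then have nz: "x ! pos n (i + 1) \<noteq> 0"
      and y: "y = x[pos n i := x ! pos n i + 1, pos n (i + 1) := x ! pos n (i + 1) - 1]"
      by (auto simp: KR_e_def entry_def split: if_splits)
    have "y[pos n i := x ! pos n i, pos n (i + 1) := x ! pos n (i + 1)] = x"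
      using p assms by (intro nth_equalityI) (simp_all add: y nth_list_update)
    then show "KR_f n i y = Some x"
      using p assms nz by (simp add: KR_f_def entry_def y)
  next
    assume f: "KR_f n i y = Some x"
    then have nz: "y ! pos n i \<noteq> 0"
      and x: "x = y[pos n i := y ! pos n i - 1, pos n (i + 1) := y ! pos n (i + 1) + 1]"
      by (auto simp: KR_f_def entry_def split: if_splits)
    have "x[pos n i := y ! pos n i, pos n (i + 1) := y ! pos n (i + 1)] = y"
      using p assms by (intro nth_equalityI) (simp_all add: x nth_list_update)
    then show "KR_e n i x = Some y"
      using p assms nz by (simp add: KR_e_def entry_def x)
  qed
qed

lemma lookup_KR_wt:
  "Poly_Mapping.lookup (KR_wt n x) j =
    (if j \<in> I n then int (entry n x j) - int (entry n x (j + 1)) else 0)"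
  by (simp add: KR_wt_def lookup_sum lookup_single when_def I_def if_distrib sum.delta cong: if_cong)

lemma lookup_simple_root:
  "Poly_Mapping.lookup (simple_root n i) j = (if j = i mod int n then 2 else 0)
    - (if j = (i - 1) mod int n then 1 else 0) - (if j = (i + 1) mod int n then 1 else 0)"
  unfolding simple_root_def fund_weight_def lookup_minus lookup_add lookup_single
  by (simp add: when_def)

text \<open>Moving a unit from index \<open>i + 1\<close> to \<open>i\<close> changes the
  differences of neighbours by 2 at \<open>i\<close> and by -1 at each of \<open>i - 1\<close> and
  \<open>i + 1\<close>. For \<open>n = 2\<close> the last two coincide and both sides add up to
  -2.\<close>

lemma KR_e_wt:
  assumes "n \<ge> 2" "length x = n" "KR_e n i x = Some y"
  shows "KR_wt n y = KR_wt n x + simple_root n i"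
proof (rule poly_mapping_eqI)
  fix j
  show "Poly_Mapping.lookup (KR_wt n y) j = Poly_Mapping.lookup (KR_wt n x + simple_root n i) j"
  proof (cases "j \<in> I n")
    case True
    then have "j mod int n = j" by (simp add: I_def)
    moreover have "(j + 1) mod int n = (i + 1) mod int n \<longleftrightarrow> j mod int n = i mod int n"
      "(j + 1) mod int n = i mod int n \<longleftrightarrow> j mod int n = (i - 1) mod int n"
      by (simp_all add: mod_eq_dvd_iff algebra_simps)
    ultimately show ?thesis
      using True
      by (auto simp: lookup_KR_wt lookup_add lookup_simple_root KR_e_entry[OF assms])
  next
    case False
    then have "l mod int n \<noteq> j" for l
      using assms(1) by (auto simp: I_def)
    with False show ?thesis
      by (auto simp: lookup_KR_wt lookup_add lookup_simple_root)
  qed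
qed

lemma affine_crystal_KR:
  assumes "n \<ge> 2"
  shows "affine_crystal n (KR_crystal n s)"
proof -
  have len: "length x = n" if "x \<in> tuples n s" for x
    using that by (simp add: tuples_def)
  have neq: "i mod int n \<noteq> (i + 1) mod int n" for i
    using assms by (simp add: mod_eq_dvd_iff)
  have e: "y \<in> tuples n s" "KR_wt n y = KR_wt n x + simple_root n i"
    "int (entry n y i) = int (entry n x i) + 1"
    "int (entry n y (i + 1)) = int (entry n x (i + 1)) - 1"
    if "x \<in> tuples n s" "KR_e n i x = Some y" for x y i
    using that assms neq[of i] KR_e_in_tuples KR_e_wt KR_e_entry[OF assms len that(2)]
    by (auto simp: len)
  have f: "y \<in> tuples n s" "KR_wt n y = KR_wt n x - simple_root n i"
    "int (entry n y i) = int (entry n x i) - 1"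
    "int (entry n y (i + 1)) = int (entry n x (i + 1)) + 1"
    if "x \<in> tuples n s" "KR_f n i x = Some y" for x y i
  proof -
    show y: "y \<in> tuples n s"
      by (rule KR_f_in_tuples[OF assms that])
    \<comment> \<open>The claims for \<open>f\<close> are those for \<open>e\<close> with
      \<open>x\<close> and \<open>y\<close> exchanged.\<close>
    then have "KR_e n i y = Some x"
      using that assms by (simp add: KR_e_iff_KR_f len)
    from e[OF y this] show "KR_wt n y = KR_wt n x - simple_root n i"
      "int (entry n y i) = int (entry n x i) - 1"
      "int (entry n y (i + 1)) = int (entry n x (i + 1)) + 1"
      by simp_all
  qed
  show ?thesis
  proof
    show "Poly_Mapping.keys (wt (KR_crystal n s) b) \<subseteq> I n" for b
      by (auto simp: KR_crystal_def in_keys_iff lookup_KR_wt split: if_splits)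
    show "e_op (KR_crystal n s) i x = Some y \<longleftrightarrow> f_op (KR_crystal n s) i y = Some x"
      if "x \<in> elems (KR_crystal n s)" "y \<in> elems (KR_crystal n s)" for i x y
      using that assms by (simp add: KR_crystal_def len KR_e_iff_KR_f)
    show "y \<in> elems (KR_crystal n s)"
      if "x \<in> elems (KR_crystal n s)" "e_op (KR_crystal n s) i x = Some y" for i x y
      using that e(1)[of x i y] by (simp add: KR_crystal_def)
    show "y \<in> elems (KR_crystal n s)"
      if "x \<in> elems (KR_crystal n s)" "f_op (KR_crystal n s) i x = Some y" for i x y
      using that f(1)[of x i y] by (simp add: KR_crystal_def)
  qed (simp_all add: KR_crystal_def lookup_KR_wt e(2-4) f(2-4))
qed


section \<open>The monomials of a tuple\<close>

definition tuple_mon :: "nat \<Rightarrow> nat list \<Rightarrow> monomial" where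
  "tuple_mon n x =
     (\<Sum>i = 1..int n. Y_pow n (i - 1) 1 (- int (entry n x i)) + Y_pow n i 0 (int (entry n x i)))"

lemma M1_eq: "M1 n s = tuple_mon n ` tuples n s"
  by (auto simp: M1_def tuple_mon_def)

lemma lookup_tuple_mon:
  assumes "n > 0"
  shows "Poly_Mapping.lookup (tuple_mon n x) (j, k) =
    (if j \<in> I n then if k = 0 then int (entry n x j) else if k = 1 then - int (entry n x (j + 1)) else 0
     else 0)"
proof (cases "j \<in> I n")
  case False
  then have "l mod int n \<noteq> j" for l
    using assms by (auto simp: I_def)
  with False show ?thesis
    by (auto simp: tuple_mon_def lookup_sum lookup_add Y_pow_def lookup_single when_def I_def
        intro!: sum.neutral)
next
  case True
  \<comment> \<open>The product runs over 1 to \<open>n\<close>, whereas \<open>I n\<close> starts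
    at 0, so the residue 0 is represented by \<open>n\<close>. The index \<open>j + 1\<close>
    already lies in the range.\<close>
  define j0 where "j0 = (if j = 0 then int n else j)"
  have j0: "i mod int n = j \<longleftrightarrow> i = j0" if "i \<in> {1..int n}" for i
    using that True by (cases "i = int n") (auto simp: I_def j0_def)
  have j1: "(i - 1) mod int n = j \<longleftrightarrow> i = j + 1" if "i \<in> {1..int n}" for i
    using that True by (auto simp: I_def)
  have in_range: "j0 \<in> {1..int n}" "j + 1 \<in> {1..int n}"
    using True assms by (auto simp: I_def j0_def)
  have entry_j0: "entry n x j0 = entry n x j"
    using assms by (intro entry_cong) (auto simp: j0_def)
  have "Poly_Mapping.lookup (tuple_mon n x) (j, k) =
    (\<Sum>i = 1..int n. (if i = j + 1 then if k = 1 then - int (entry n x i) else 0 else 0)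
      + (if i = j0 then if k = 0 then int (entry n x i) else 0 else 0))"
    unfolding tuple_mon_def lookup_sum
    by (intro sum.cong refl) (auto simp: lookup_add Y_pow_def lookup_single when_def j0 j1)
  also have "\<dots> = (if k = 1 then - int (entry n x (j + 1)) else 0)
      + (if k = 0 then int (entry n x j) else 0)"
    using in_range by (simp add: sum.distrib sum.delta entry_j0 del: atLeastAtMost_iff)
  finally show ?thesis using True by simp
qed

lemma keys_tuple_mon: "n > 0 \<Longrightarrow> Poly_Mapping.keys (tuple_mon n x) \<subseteq> I n \<times> {0, 1}"
  by (auto simp: in_keys_iff lookup_tuple_mon split: if_splits)

text \<open>The exponents at second index 0 are the entries themselves.\<close>

lemma inj_on_tuple_mon:
  assumes "n > 0"
  shows "inj_on (tuple_mon n) (tuples n s)"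
proof (rule inj_onI)
  fix x y assume xy: "x \<in> tuples n s" "y \<in> tuples n s" "tuple_mon n x = tuple_mon n y"
  show "x = y"
  proof (rule tuple_eqI)
    fix i assume "i \<in> I n"
    then show "entry n x i = entry n y i"
      using arg_cong[OF xy(3), of "\<lambda>m. Poly_Mapping.lookup m (i, 0)"] assms
      by (simp add: lookup_tuple_mon)
  qed (use xy in \<open>auto simp: tuples_def\<close>)
qed

section \<open>Weights, partial sums and their extrema\<close>

lemma mon_wt_tuple_mon:
  assumes "n > 0"
  shows "mon_wt n (tuple_mon n x) = KR_wt n x"
proof -
  let ?m = "tuple_mon n x"
  \<comment> \<open>Enlarging the support to a full rectangle adds only zero terms and lets the two
    levels be summed for each index.\<close>
  have "mon_wt n ?m =
    (\<Sum>(i, k) \<in> I n \<times> {0, 1}. Poly_Mapping.single (i mod int n) (Poly_Mapping.lookup ?m (i, k)))"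
    unfolding mon_wt_def using keys_tuple_mon[OF assms]
    by (intro sum.mono_neutral_left) (auto simp: I_def in_keys_iff)
  also have "\<dots> = (\<Sum>i\<in>I n. \<Sum>k\<in>{0, 1}.
      Poly_Mapping.single (i mod int n) (Poly_Mapping.lookup ?m (i, k)))"
    by (rule sum.cartesian_product[symmetric])
  also have "\<dots> = KR_wt n x"
    unfolding KR_wt_def using assms
    by (intro sum.cong refl) (auto simp: lookup_tuple_mon I_def single_add[symmetric])
  finally show ?thesis .
qed

lemma upper_sum_tuple_mon:
  assumes "n > 0" "i \<in> I n"
  shows "upper_sum i (tuple_mon n x) k =
    (if k \<le> 0 then int (entry n x i) - int (entry n x (i + 1))
     else if k \<le> 1 then - int (entry n x (i + 1)) else 0)"
proof -
  have "upper_sum i (tuple_mon n x) k =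
    (\<Sum>t\<in>{t\<in>{0, 1}. k \<le> t}. Poly_Mapping.lookup (tuple_mon n x) (i, t))"
    unfolding upper_sum_def using keys_tuple_mon[OF assms(1), of x]
    by (intro sum.mono_neutral_left) (auto simp: in_keys_iff)
  also have "{t\<in>{0, 1}. k \<le> t} = (if k \<le> 0 then {0, 1} else if k \<le> 1 then {1} else {})"
    by auto
  finally show ?thesis using assms by (simp add: lookup_tuple_mon)
qed

lemma lower_sum_tuple_mon:
  assumes "n > 0" "i \<in> I n"
  shows "lower_sum i (tuple_mon n x) k =
    (if 1 \<le> k then int (entry n x i) - int (entry n x (i + 1))
     else if 0 \<le> k then int (entry n x i) else 0)"
proof -
  have "lower_sum i (tuple_mon n x) k =
    (\<Sum>t\<in>{t\<in>{0, 1}. t \<le> k}. Poly_Mapping.lookup (tuple_mon n x) (i, t))"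
    unfolding lower_sum_def using keys_tuple_mon[OF assms(1), of x]
    by (intro sum.mono_neutral_left) (auto simp: in_keys_iff)
  also have "{t\<in>{0, 1}. t \<le> k} = (if 1 \<le> k then {0, 1} else if 0 \<le> k then {0} else {})"
    by auto
  finally show ?thesis using assms by (simp add: lookup_tuple_mon)
qed

lemma mon_eps_tuple_mon:
  assumes "n > 0" "i \<in> I n"
  shows "mon_eps i (tuple_mon n x) = int (entry n x (i + 1))"
proof -
  have "Min (range (upper_sum i (tuple_mon n x))) = - int (entry n x (i + 1))"
  proof (rule Min_eqI)
    show "finite (range (upper_sum i (tuple_mon n x)))"
      by (rule finite_subset[of _ "{int (entry n x i) - int (entry n x (i + 1)),
            - int (entry n x (i + 1)), 0}"])
         (auto simp: upper_sum_tuple_mon[OF assms])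
    \<comment> \<open>The value at 1 is minimal since the other values, 0 and the difference, exceed
      it by a nonnegative entry.\<close>
    show "- int (entry n x (i + 1)) \<in> range (upper_sum i (tuple_mon n x))"
      by (rule range_eqI[of _ _ 1]) (simp add: upper_sum_tuple_mon[OF assms])
  qed (auto simp: upper_sum_tuple_mon[OF assms])
  then show ?thesis by (simp add: mon_eps_def)
qed

lemma mon_phi_tuple_mon:
  assumes "n > 0" "i \<in> I n"
  shows "mon_phi i (tuple_mon n x) = int (entry n x i)"
  unfolding mon_phi_def
proof (rule Max_eqI)
  show "finite (range (lower_sum i (tuple_mon n x)))"
    by (rule finite_subset[of _ "{int (entry n x i) - int (entry n x (i + 1)),
          int (entry n x i), 0}"])
       (auto simp: lower_sum_tuple_mon[OF assms])
  show "int (entry n x i) \<in> range (lower_sum i (tuple_mon n x))"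
    by (rule range_eqI[of _ _ 0]) (simp add: lower_sum_tuple_mon[OF assms])
qed (auto simp: lower_sum_tuple_mon[OF assms])

text \<open>Above 1 the upper sum is 0, which is not the minimum when the entry is nonzero; if it
  were zero, the minimum would be attained at arbitrarily large \<open>k\<close>.\<close>

lemma k_e_tuple_mon:
  assumes "n > 0" "i \<in> I n" "entry n x (i + 1) \<noteq> 0"
  shows "k_e i (tuple_mon n x) = 1"
  unfolding k_e_def mon_eps_tuple_mon[OF assms(1,2)] upper_sum_tuple_mon[OF assms(1,2)]
  using assms(3) by (intro Greatest_equality) (auto split: if_splits)

text \<open>Below 0 the lower sum is 0, short of the maximum when the entry is nonzero.\<close>

lemma k_f_tuple_mon:
  assumes "n > 0" "i \<in> I n" "entry n x i \<noteq> 0"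
  shows "k_f i (tuple_mon n x) = 0"
  unfolding k_f_def mon_phi_tuple_mon[OF assms(1,2)] lower_sum_tuple_mon[OF assms(1,2)]
  using assms(3) by (intro Least_equality) (auto split: if_splits)

section \<open>Operators on the monomials and the isomorphism\<close>

lemma tuple_mon_KR_e:
  assumes "n \<ge> 2" "length x = n" "KR_e n i x = Some y"
  shows "tuple_mon n y = tuple_mon n x + A_mon n i 0"
proof (rule poly_mapping_eqI)
  fix jk :: "int \<times> int"
  obtain j k where jk: "jk = (j, k)" by (cases jk)
  have n: "n > 0" using assms(1) by simp
  show "Poly_Mapping.lookup (tuple_mon n y) jk =
    Poly_Mapping.lookup (tuple_mon n x + A_mon n i 0) jk"
  proof (cases "j \<in> I n")
    case True
    then have "j mod int n = j" by (simp add: I_def)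
    moreover have "(j + 1) mod int n = (i + 1) mod int n \<longleftrightarrow> j mod int n = i mod int n"
      "(j + 1) mod int n = i mod int n \<longleftrightarrow> j mod int n = (i - 1) mod int n"
      by (simp_all add: mod_eq_dvd_iff algebra_simps)
    \<comment> \<open>At level 0 the exponents follow the entries: up at \<open>i\<close>, down at
      \<open>i + 1\<close>. At level 1 they are negated and shifted: up at \<open>i\<close>, down at
      \<open>i - 1\<close>. These are the four factors of \<open>A_mon n i 0\<close>.\<close>
    ultimately show ?thesis
      using True n
      by (auto simp: jk lookup_tuple_mon lookup_add A_mon_def Y_pow_def
          lookup_single when_def KR_e_entry[OF assms])
  next
    case False
    then have "l mod int n \<noteq> j" for l
      using n by (auto simp: I_def)
    with False show ?thesis
      using n by (auto simp: jk lookup_tuple_mon lookup_add A_mon_def Y_pow_def lookup_single)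
  qed
qed

lemma mon_e_tuple_mon:
  assumes "n \<ge> 2" "i \<in> I n" "length x = n"
  shows "mon_e n i (tuple_mon n x) = map_option (tuple_mon n) (KR_e n i x)"
proof (cases "KR_e n i x")
  case None
  then show ?thesis
    using assms by (auto simp: mon_e_def mon_eps_tuple_mon KR_e_def split: if_splits)
next
  case (Some y)
  then have "entry n x (i + 1) \<noteq> 0" by (auto simp: KR_e_def split: if_splits)
  \<comment> \<open>The shift by one in \<open>mon_e\<close> turns \<open>k_e = 1\<close> into the
    factor at level 0.\<close>
  with Some show ?thesis
    using assms tuple_mon_KR_e[OF assms(1,3) Some]
    by (simp add: mon_e_def mon_eps_tuple_mon k_e_tuple_mon)
qed

lemma mon_f_tuple_mon:
  assumes "n \<ge> 2" "i \<in> I n" "length x = n"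
  shows "mon_f n i (tuple_mon n x) = map_option (tuple_mon n) (KR_f n i x)"
proof (cases "KR_f n i x")
  case None
  then show ?thesis
    using assms by (auto simp: mon_f_def mon_phi_tuple_mon KR_f_def split: if_splits)
next
  case (Some y)
  then have x: "entry n x i \<noteq> 0" and y: "length y = n"
    using assms(3) by (auto simp: KR_f_def split: if_splits)
  \<comment> \<open>The formula for \<open>e\<close> at \<open>y\<close>, solved for the monomial of
    \<open>y\<close>, gives division by the same factor; \<open>k_f = 0\<close> enters
    \<open>mon_f\<close> without a shift.\<close>
  then have "KR_e n i y = Some x"
    using Some assms by (simp add: KR_e_iff_KR_f)
  then have "tuple_mon n y = tuple_mon n x - A_mon n i 0"
    by (simp add: tuple_mon_KR_e[OF assms(1) y])
  with Some x show ?thesis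
    using assms by (simp add: mon_f_def mon_phi_tuple_mon k_f_tuple_mon)
qed

lemma crystal_iso_tuple_mon:
  assumes "n \<ge> 2"
  shows "crystal_iso n (KR_crystal n s) (restrict_elems (nakajima_monomials n) (M1 n s)) (tuple_mon n)"
proof -
  have n: "n > 0" using assms by simp
  have len: "length x = n" if "x \<in> tuples n s" for x
    using that by (simp add: tuples_def)
  show ?thesis
    unfolding crystal_iso_def KR_crystal_def restrict_elems_def nakajima_monomials_def M1_eq
    by (simp add: bij_betw_def inj_on_tuple_mon[OF n] mon_wt_tuple_mon[OF n]
        mon_eps_tuple_mon[OF n] mon_phi_tuple_mon[OF n] mon_e_tuple_mon[OF assms]
        mon_f_tuple_mon[OF assms] len)
qed

theorem theorem3p1:
  fixes n s :: nat
  assumes "n \<ge> 3" and "s \<ge> 1"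
  shows "M1 n s \<subseteq> elems (nakajima_monomials n) \<and>
    crystal_isomorphic n (restrict_elems (nakajima_monomials n) (M1 n s)) (KR_crystal n s)"
proof
  have n: "n \<ge> 2" using assms(1) by simp
  show "M1 n s \<subseteq> elems (nakajima_monomials n)"
  proof
    fix m assume "m \<in> M1 n s"
    then obtain x where "m = tuple_mon n x" by (auto simp: M1_eq)
    then show "m \<in> elems (nakajima_monomials n)"
      using n keys_tuple_mon[of n x] by (auto simp: nakajima_monomials_def)
  qed
  show "crystal_isomorphic n (restrict_elems (nakajima_monomials n) (M1 n s)) (KR_crystal n s)"
    by (rule crystal_isomorphic_if_iso_from[OF affine_crystal_KR[OF n] crystal_iso_tuple_mon[OF n]])
qed

end
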